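(* For any CS-interpretation $^*$ whose verification predicate satisfies conditions (V1)–(V2) below, every theorem $F$ of $\mathsf{LPV^-}\text{-}\mathcal{CS}$ is provably valid under the constant specification $\mathcal{CS}$: \[ \mathsf{LPV^-}\text{-}\mathcal{CS} \vdash F \ \Rightarrow \ \mathsf{PA} \vdash F^*. \]
   Context: The language of $\mathsf{LPV^-}$ is classical propositional logic extended with a verification operator ${\bf V}$ and proof terms built from proof variables and proof constants by binary application $\cdot$, binary plus $+$ and unary proof checker $!$; formulas include ${\bf V}A$ and $t{:}A$ ("$t$ is a proof of $A$"). $\mathsf{LPV^-}$ has axioms: classical propositional tautologies; $t{:}(A\to B)\to(s{:}A\to (t\cdot s){:}B)$; $t{:}A\to A$; $t{:}A\to\, !t{:}t{:}A$; $t{:}A\to (s+t){:}A$ and $t{:}A\to(t+s){:}A$; ${\bf V}(A\to B)\to({\bf V}A\to{\bf V}B)$; $t{:}A\to{\bf V}A$; rules: Modus Ponens and Axiom Necessitation (from an axiom $A$ infer $c{:}A$ for a proof constant $c$). A constant specification $\mathcal{CS}$ is a set of formulas $c_i{:}A_i$ with $A_i$ an axiom and $c_i$ a proof constant; $\mathsf{LPV^-}\text{-}\mathcal{CS}$ is $\mathsf{LPV^-}$ without the Axiom Necessitation rule but with the members of $\mathcal{CS}$ as extra axioms. A normal proof predicate is a provably $\Delta$ arithmetical formula $\mathsf{Prf}(x,y)$ such that for every arithmetical sentence $F$: $\mathsf{PA}\vdash F$ iff $\mathsf{Prf}(n,F)$ holds for some $n$; each $k$ proves only finitely many formulas; and for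 any $k,l$ there is $n$ proving everything $k$ and $l$ prove. For such a predicate there are recursive functions $\mathsf{m},\mathsf{a},\mathsf{c}$ with $(\mathsf{Prf}(k,F\to G)\land\mathsf{Prf}(n,F))\to\mathsf{Prf}(\mathsf{m}(k,n),G)$, $\mathsf{Prf}(k,F)\to\mathsf{Prf}(\mathsf{a}(k,n),F)$, $\mathsf{Prf}(n,F)\to\mathsf{Prf}(\mathsf{a}(k,n),F)$, and $\mathsf{Prf}(k,F)\to\mathsf{Prf}(\mathsf{c}(k),\mathsf{Prf}(k,F))$. A verification predicate is a provably $\Sigma$ formula $\mathsf{Ver}(x)$ such that for all arithmetical formulas $F,G$: (V1) $\mathsf{PA}\vdash \mathsf{Ver}(F\to G)\to(\mathsf{Ver}(F)\to\mathsf{Ver}(G))$; (V2) for each $n$, $\mathsf{PA}\vdash\mathsf{Prf}(n,F)\to\mathsf{Ver}(F)$. An arithmetical interpretation $^*$ consists of a normal proof predicate $\mathsf{Prf}$ with $\mathsf{m},\mathsf{a},\mathsf{c}$, a verification predicate $\mathsf{Ver}$, an evaluation of propositional letters by $\mathsf{PA}$ sentences and of proof variables and constants by natural numbers, extended by: $\bot^*=\bot$, $^*$ commutes with $\land,\lor,\to$, $(t\cdot s)^*=\mathsf{m}(t^*,s^* )$, $(t+s)^*=\mathsf{a}(t^*,s^* )$, $(!t)^*=\mathsf{c}(t^* )$, $(t{:}F)^*=\mathsf{Prf}(t^*,F^* )$, $({\bf V}F)^*=\mathsf{Ver}(F^* )$. A CS-interpretation is an interpretation under which all formulas of $\mathcal{CS}^*$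 are true; $F$ is provably valid under $\mathcal{CS}$ if $\mathsf{PA}\vdash F^*$ for every CS-interpretation $^*$. *)

theory Defs
  imports Main "HOL-Library.Nat_Bijection"
begin

section \<open>First-order arithmetic\<close>

text \<open>The language is that of zero, successor, addition, multiplication, equality and order.
  Variables are de Bruijn indices: the quantifiers bind index 0 and shift the other indices
  by one.\<close>

datatype tm = Var nat | Zero | Succ tm | Add tm tm | Mul tm tm

datatype fm =
    Eq tm tm
  | Less tm tm
  | Bot
  | And fm fm
  | Or fm fm
  | Imp fm fm
  | All fm
  | Ex fm

abbreviation Neg :: "fm \<Rightarrow> fm" where
  "Neg F \<equiv> Imp F Bot"

abbreviation Iff :: "fm \<Rightarrow> fm \<Rightarrow> fm" where
  "Iff F G \<equiv> And (Imp F G) (Imp G F)"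

primrec fv_tm :: "tm \<Rightarrow> nat set" where
  "fv_tm (Var i) = {i}"
| "fv_tm Zero = {}"
| "fv_tm (Succ t) = fv_tm t"
| "fv_tm (Add s t) = fv_tm s \<union> fv_tm t"
| "fv_tm (Mul s t) = fv_tm s \<union> fv_tm t"

primrec fv :: "fm \<Rightarrow> nat set" where
  "fv (Eq s t) = fv_tm s \<union> fv_tm t"
| "fv (Less s t) = fv_tm s \<union> fv_tm t"
| "fv Bot = {}"
| "fv (And F G) = fv F \<union> fv G"
| "fv (Or F G) = fv F \<union> fv G"
| "fv (Imp F G) = fv F \<union> fv G"
| "fv (All F) = {i. Suc i \<in> fv F}"
| "fv (Ex F) = {i. Suc i \<in> fv F}"

definition sentence :: "fm \<Rightarrow> bool" where
  "sentence F \<longleftrightarrow> fv F = {}"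

primrec subst_tm :: "(nat \<Rightarrow> tm) \<Rightarrow> tm \<Rightarrow> tm" where
  "subst_tm \<sigma> (Var i) = \<sigma> i"
| "subst_tm \<sigma> Zero = Zero"
| "subst_tm \<sigma> (Succ t) = Succ (subst_tm \<sigma> t)"
| "subst_tm \<sigma> (Add s t) = Add (subst_tm \<sigma> s) (subst_tm \<sigma> t)"
| "subst_tm \<sigma> (Mul s t) = Mul (subst_tm \<sigma> s) (subst_tm \<sigma> t)"

definition lift_tm :: "tm \<Rightarrow> tm" where
  "lift_tm = subst_tm (\<lambda>i. Var (Suc i))"

definition push :: "(nat \<Rightarrow> tm) \<Rightarrow> nat \<Rightarrow> tm" where
  "push \<sigma> = case_nat (Var 0) (\<lambda>i. lift_tm (\<sigma> i))"

text \<open>Simultaneous capture-avoiding substitution.\<close>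

primrec subst :: "(nat \<Rightarrow> tm) \<Rightarrow> fm \<Rightarrow> fm" where
  "subst \<sigma> (Eq s t) = Eq (subst_tm \<sigma> s) (subst_tm \<sigma> t)"
| "subst \<sigma> (Less s t) = Less (subst_tm \<sigma> s) (subst_tm \<sigma> t)"
| "subst \<sigma> Bot = Bot"
| "subst \<sigma> (And F G) = And (subst \<sigma> F) (subst \<sigma> G)"
| "subst \<sigma> (Or F G) = Or (subst \<sigma> F) (subst \<sigma> G)"
| "subst \<sigma> (Imp F G) = Imp (subst \<sigma> F) (subst \<sigma> G)"
| "subst \<sigma> (All F) = All (subst (push \<sigma>) F)"
| "subst \<sigma> (Ex F) = Ex (subst (push \<sigma>) F)"

text \<open>\<open>inst F t\<close> is the body \<open>F\<close> of a quantifier with \<open>t\<close> put for the bound variable.\<close>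

definition inst :: "fm \<Rightarrow> tm \<Rightarrow> fm" where
  "inst F t = subst (case_nat t Var) F"

definition lift :: "fm \<Rightarrow> fm" where
  "lift = subst (\<lambda>i. Var (Suc i))"

primrec numeral_tm :: "nat \<Rightarrow> tm" where
  "numeral_tm 0 = Zero"
| "numeral_tm (Suc n) = Succ (numeral_tm n)"

subsection \<open>The standard model\<close>

primrec eval_tm :: "(nat \<Rightarrow> nat) \<Rightarrow> tm \<Rightarrow> nat" where
  "eval_tm e (Var i) = e i"
| "eval_tm e Zero = 0"
| "eval_tm e (Succ t) = Suc (eval_tm e t)"
| "eval_tm e (Add s t) = eval_tm e s + eval_tm e t"
| "eval_tm e (Mul s t) = eval_tm e s * eval_tm e t"

primrec sat :: "(nat \<Rightarrow> nat) \<Rightarrow> fm \<Rightarrow> bool" where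
  "sat e (Eq s t) \<longleftrightarrow> eval_tm e s = eval_tm e t"
| "sat e (Less s t) \<longleftrightarrow> eval_tm e s < eval_tm e t"
| "sat e Bot \<longleftrightarrow> False"
| "sat e (And F G) \<longleftrightarrow> sat e F \<and> sat e G"
| "sat e (Or F G) \<longleftrightarrow> sat e F \<or> sat e G"
| "sat e (Imp F G) \<longleftrightarrow> (sat e F \<longrightarrow> sat e G)"
| "sat e (All F) \<longleftrightarrow> (\<forall>n. sat (case_nat n e) F)"
| "sat e (Ex F) \<longleftrightarrow> (\<exists>n. sat (case_nat n e) F)"

definition arith_true :: "fm \<Rightarrow> bool" where
  "arith_true F \<longleftrightarrow> (\<forall>e. sat e F)"

subsection \<open>Peano arithmetic\<close>

text \<open>Propositional evaluation treats atomic and quantified formulas as propositional atoms,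
  whose values are given by \<open>v\<close>.\<close>

primrec prop_eval :: "(fm \<Rightarrow> bool) \<Rightarrow> fm \<Rightarrow> bool" where
  "prop_eval v (Eq s t) \<longleftrightarrow> v (Eq s t)"
| "prop_eval v (Less s t) \<longleftrightarrow> v (Less s t)"
| "prop_eval v Bot \<longleftrightarrow> False"
| "prop_eval v (And F G) \<longleftrightarrow> prop_eval v F \<and> prop_eval v G"
| "prop_eval v (Or F G) \<longleftrightarrow> prop_eval v F \<or> prop_eval v G"
| "prop_eval v (Imp F G) \<longleftrightarrow> (prop_eval v F \<longrightarrow> prop_eval v G)"
| "prop_eval v (All F) \<longleftrightarrow> v (All F)"
| "prop_eval v (Ex F) \<longleftrightarrow> v (Ex F)"

text \<open>The recursion equations for \<open><\<close> are those of Shoenfield's formulation of Peano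
  arithmetic. In the induction scheme, \<open>F\<close> with the successor of variable 0 put for variable 0
  and all other variables unchanged is \<open>F(x + 1)\<close>.\<close>

inductive_set PA_axioms :: "fm set" where
  "Neg (Eq (Succ t) Zero) \<in> PA_axioms"
| "Imp (Eq (Succ s) (Succ t)) (Eq s t) \<in> PA_axioms"
| "Eq (Add s Zero) s \<in> PA_axioms"
| "Eq (Add s (Succ t)) (Succ (Add s t)) \<in> PA_axioms"
| "Eq (Mul s Zero) Zero \<in> PA_axioms"
| "Eq (Mul s (Succ t)) (Add (Mul s t) s) \<in> PA_axioms"
| "Neg (Less t Zero) \<in> PA_axioms"
| "Iff (Less s (Succ t)) (Or (Less s t) (Eq s t)) \<in> PA_axioms"
| "Imp (inst F Zero)
     (Imp (All (Imp F (subst (case_nat (Succ (Var 0)) (\<lambda>i. Var (Suc i))) F)))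
       (All F)) \<in> PA_axioms"

text \<open>A Hilbert-style calculus for classical first-order logic with equality. Free variables of
  theorems are implicitly universally quantified.\<close>

inductive PA_proves :: "fm \<Rightarrow> bool" (\<open>PA \<turnstile> _\<close> [50] 50) where
  PA_ax: "F \<in> PA_axioms \<Longrightarrow> PA \<turnstile> F"
| PA_taut: "(\<And>v. prop_eval v F) \<Longrightarrow> PA \<turnstile> F"
| PA_eq_refl: "PA \<turnstile> Eq t t"
| PA_eq_subst: "PA \<turnstile> Imp (Eq s t) (Imp (inst F s) (inst F t))"
| PA_all_elim: "PA \<turnstile> Imp (All F) (inst F t)"
| PA_ex_intro: "PA \<turnstile> Imp (inst F t) (Ex F)"
| PA_mp: "PA \<turnstile> Imp F G \<Longrightarrow> PA \<turnstile> F \<Longrightarrow> PA \<turnstile> G"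
| PA_all_intro: "PA \<turnstile> Imp (lift G) F \<Longrightarrow> PA \<turnstile> Imp G (All F)"
| PA_ex_elim: "PA \<turnstile> Imp F (lift G) \<Longrightarrow> PA \<turnstile> Imp (Ex F) G"

subsection \<open>Arithmetical hierarchy\<close>

text \<open>The lifting of \<open>t\<close> in the bounded quantifiers ensures that the bound variable does not
  occur in the bound.\<close>

inductive Delta0 :: "fm \<Rightarrow> bool" where
  "Delta0 (Eq s t)"
| "Delta0 (Less s t)"
| "Delta0 Bot"
| "Delta0 F \<Longrightarrow> Delta0 G \<Longrightarrow> Delta0 (And F G)"
| "Delta0 F \<Longrightarrow> Delta0 G \<Longrightarrow> Delta0 (Or F G)"
| "Delta0 F \<Longrightarrow> Delta0 G \<Longrightarrow> Delta0 (Imp F G)"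
| "Delta0 F \<Longrightarrow> Delta0 (All (Imp (Less (Var 0) (lift_tm t)) F))"
| "Delta0 F \<Longrightarrow> Delta0 (Ex (And (Less (Var 0) (lift_tm t)) F))"

inductive Sigma1 :: "fm \<Rightarrow> bool" where
  "Delta0 F \<Longrightarrow> Sigma1 F"
| "Sigma1 F \<Longrightarrow> Sigma1 (Ex F)"

inductive Pi1 :: "fm \<Rightarrow> bool" where
  "Delta0 F \<Longrightarrow> Pi1 F"
| "Pi1 F \<Longrightarrow> Pi1 (All F)"

definition provably_Sigma :: "fm \<Rightarrow> bool" where
  "provably_Sigma F \<longleftrightarrow> (\<exists>G. Sigma1 G \<and> PA \<turnstile> Iff F G)"

definition provably_Delta :: "fm \<Rightarrow> bool" where
  "provably_Delta F \<longleftrightarrow>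
    (\<exists>G. Sigma1 G \<and> PA \<turnstile> Iff F G) \<and> (\<exists>H. Pi1 H \<and> PA \<turnstile> Iff F H)"

subsection \<open>Goedel numbering\<close>

primrec gn_tm :: "tm \<Rightarrow> nat" where
  "gn_tm (Var i) = prod_encode (0, i)"
| "gn_tm Zero = prod_encode (1, 0)"
| "gn_tm (Succ t) = prod_encode (2, gn_tm t)"
| "gn_tm (Add s t) = prod_encode (3, prod_encode (gn_tm s, gn_tm t))"
| "gn_tm (Mul s t) = prod_encode (4, prod_encode (gn_tm s, gn_tm t))"

primrec gn :: "fm \<Rightarrow> nat" where
  "gn (Eq s t) = prod_encode (0, prod_encode (gn_tm s, gn_tm t))"
| "gn (Less s t) = prod_encode (1, prod_encode (gn_tm s, gn_tm t))"
| "gn Bot = prod_encode (2, 0)"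
| "gn (And F G) = prod_encode (3, prod_encode (gn F, gn G))"
| "gn (Or F G) = prod_encode (4, prod_encode (gn F, gn G))"
| "gn (Imp F G) = prod_encode (5, prod_encode (gn F, gn G))"
| "gn (All F) = prod_encode (6, gn F)"
| "gn (Ex F) = prod_encode (7, gn F)"

subsection \<open>Recursive functions\<close>

text \<open>\<open>recursive k f\<close> says that \<open>f\<close> is a total recursive function of arity \<open>k\<close>; only the values
  of \<open>f\<close> at lists of length \<open>k\<close> are meaningful. Minimization is restricted to regular functions,
  so that only total functions arise.\<close>

inductive recursive :: "nat \<Rightarrow> (nat list \<Rightarrow> nat) \<Rightarrow> bool" where
  rec_zero: "recursive k (\<lambda>xs. 0)"
| rec_suc: "recursive 1 (\<lambda>xs. Suc (xs ! 0))"
| rec_proj: "i < k \<Longrightarrow> recursive k (\<lambda>xs. xs ! i)"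
| rec_comp: "recursive (length gs) f \<Longrightarrow> (\<forall>g \<in> set gs. recursive k g)
    \<Longrightarrow> recursive k (\<lambda>xs. f (map (\<lambda>g. g xs) gs))"
| rec_prec: "recursive k f \<Longrightarrow> recursive (Suc (Suc k)) g
    \<Longrightarrow> recursive (Suc k)
          (\<lambda>xs. rec_nat (f (tl xs)) (\<lambda>n r. g (n # r # tl xs)) (hd xs))"
| rec_mu: "recursive (Suc k) f \<Longrightarrow> (\<forall>xs. length xs = k \<longrightarrow> (\<exists>n. f (n # xs) = 0))
    \<Longrightarrow> recursive k (\<lambda>xs. LEAST n. f (n # xs) = 0)"

definition recursive1 :: "(nat \<Rightarrow> nat) \<Rightarrow> bool" where
  "recursive1 f \<longleftrightarrow> (\<exists>g. recursive 1 g \<and> (\<forall>x. f x = g [x]))"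

definition recursive2 :: "(nat \<Rightarrow> nat \<Rightarrow> nat) \<Rightarrow> bool" where
  "recursive2 f \<longleftrightarrow> (\<exists>g. recursive 2 g \<and> (\<forall>x y. f x y = g [x, y]))"

section \<open>Proof and verification predicates\<close>

text \<open>\<open>Prf(x, y)\<close> is given as a formula whose variables 0 and 1 play the roles of \<open>x\<close> and \<open>y\<close>;
  \<open>prf_app P n F\<close> is the sentence \<open>Prf(n, F)\<close>, with \<open>n\<close> replaced by its numeral and \<open>F\<close> by the
  numeral of its Goedel number. Likewise \<open>ver_app V F\<close> is \<open>Ver(F)\<close>.\<close>

definition prf_app :: "fm \<Rightarrow> nat \<Rightarrow> fm \<Rightarrow> fm" where
  "prf_app P n F =
    subst (\<lambda>i. if i = 0 then numeral_tm n else if i = 1 then numeral_tm (gn F) else Var i) P"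

definition ver_app :: "fm \<Rightarrow> fm \<Rightarrow> fm" where
  "ver_app V F = subst (\<lambda>i. if i = 0 then numeral_tm (gn F) else Var i) V"

definition normal_proof_predicate :: "fm \<Rightarrow> bool" where
  "normal_proof_predicate P \<longleftrightarrow>
    fv P \<subseteq> {0, 1} \<and>
    provably_Delta P \<and>
    (\<forall>F. sentence F \<longrightarrow> (PA \<turnstile> F \<longleftrightarrow> (\<exists>n. arith_true (prf_app P n F)))) \<and>
    (\<forall>k. finite {F. arith_true (prf_app P k F)}) \<and>
    (\<forall>k l. \<exists>n. \<forall>F. arith_true (prf_app P k F) \<or> arith_true (prf_app P l F)
       \<longrightarrow> arith_true (prf_app P n F))"

definition proof_operations ::
  "fm \<Rightarrow> (nat \<Rightarrow> nat \<Rightarrow> nat) \<Rightarrow> (nat \<Rightarrow> nat \<Rightarrow> nat) \<Rightarrow> (nat \<Rightarrow> nat) \<Rightarrow> bool" where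
  "proof_operations P m a c \<longleftrightarrow>
    recursive2 m \<and> recursive2 a \<and> recursive1 c \<and>
    (\<forall>F G k n. sentence F \<longrightarrow> sentence G \<longrightarrow>
       arith_true (prf_app P k (Imp F G)) \<longrightarrow> arith_true (prf_app P n F)
       \<longrightarrow> arith_true (prf_app P (m k n) G)) \<and>
    (\<forall>F k n. sentence F \<longrightarrow> arith_true (prf_app P k F)
       \<longrightarrow> arith_true (prf_app P (a k n) F)) \<and>
    (\<forall>F k n. sentence F \<longrightarrow> arith_true (prf_app P n F)
       \<longrightarrow> arith_true (prf_app P (a k n) F)) \<and>
    (\<forall>F k. sentence F \<longrightarrow> arith_true (prf_app P k F)
       \<longrightarrow> arith_true (prf_app P (c k) (prf_app P k F)))"

definition verification_predicate :: "fm \<Rightarrow> fm \<Rightarrow> bool" where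
  "verification_predicate P V \<longleftrightarrow>
    fv V \<subseteq> {0} \<and>
    provably_Sigma V \<and>
    (\<forall>F G. PA \<turnstile> Imp (ver_app V (Imp F G)) (Imp (ver_app V F) (ver_app V G))) \<and>
    (\<forall>n F. PA \<turnstile> Imp (prf_app P n F) (ver_app V F))"

section \<open>The logic of proofs and verification\<close>

datatype ptm =
    PVar nat
  | PConst nat
  | App ptm ptm
  | Sum ptm ptm
  | Check ptm

datatype lfm =
    Letter nat
  | LBot
  | LAnd lfm lfm
  | LOr lfm lfm
  | LImp lfm lfm
  | Vf lfm
  | Pf ptm lfm

text \<open>Here letters and formulas with main operator \<open>Vf\<close> or \<open>Pf\<close> count as propositional
  atoms.\<close>

primrec lprop_eval :: "(lfm \<Rightarrow> bool) \<Rightarrow> lfm \<Rightarrow> bool" where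
  "lprop_eval v (Letter i) \<longleftrightarrow> v (Letter i)"
| "lprop_eval v LBot \<longleftrightarrow> False"
| "lprop_eval v (LAnd A B) \<longleftrightarrow> lprop_eval v A \<and> lprop_eval v B"
| "lprop_eval v (LOr A B) \<longleftrightarrow> lprop_eval v A \<or> lprop_eval v B"
| "lprop_eval v (LImp A B) \<longleftrightarrow> (lprop_eval v A \<longrightarrow> lprop_eval v B)"
| "lprop_eval v (Vf A) \<longleftrightarrow> v (Vf A)"
| "lprop_eval v (Pf t A) \<longleftrightarrow> v (Pf t A)"

inductive LPV_axiom :: "lfm \<Rightarrow> bool" where
  ax_taut: "(\<And>v. lprop_eval v A) \<Longrightarrow> LPV_axiom A"
| ax_app: "LPV_axiom (LImp (Pf t (LImp A B)) (LImp (Pf s A) (Pf (App t s) B)))"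
| ax_reflection: "LPV_axiom (LImp (Pf t A) A)"
| ax_check: "LPV_axiom (LImp (Pf t A) (Pf (Check t) (Pf t A)))"
| ax_sum_right: "LPV_axiom (LImp (Pf t A) (Pf (Sum s t) A))"
| ax_sum_left: "LPV_axiom (LImp (Pf t A) (Pf (Sum t s) A))"
| ax_ver_K: "LPV_axiom (LImp (Vf (LImp A B)) (LImp (Vf A) (Vf B)))"
| ax_ver_proof: "LPV_axiom (LImp (Pf t A) (Vf A))"

definition constant_specification :: "lfm set \<Rightarrow> bool" where
  "constant_specification CS \<longleftrightarrow> (\<forall>X \<in> CS. \<exists>i A. LPV_axiom A \<and> X = Pf (PConst i) A)"

inductive LPV_CS :: "lfm set \<Rightarrow> lfm \<Rightarrow> bool" for CS :: "lfm set" where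
  LPV_ax: "LPV_axiom A \<Longrightarrow> LPV_CS CS A"
| LPV_cs: "A \<in> CS \<Longrightarrow> LPV_CS CS A"
| LPV_mp: "LPV_CS CS (LImp A B) \<Longrightarrow> LPV_CS CS A \<Longrightarrow> LPV_CS CS B"

section \<open>Arithmetical interpretations\<close>

record interp =
  Prf :: fm
  op_m :: "nat \<Rightarrow> nat \<Rightarrow> nat"
  op_a :: "nat \<Rightarrow> nat \<Rightarrow> nat"
  op_c :: "nat \<Rightarrow> nat"
  Ver :: fm
  letter :: "nat \<Rightarrow> fm"
  pvar :: "nat \<Rightarrow> nat"
  pconst :: "nat \<Rightarrow> nat"

definition arithmetical_interpretation :: "interp \<Rightarrow> bool" where
  "arithmetical_interpretation I \<longleftrightarrow>
    normal_proof_predicate (Prf I) \<and>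
    proof_operations (Prf I) (op_m I) (op_a I) (op_c I) \<and>
    verification_predicate (Prf I) (Ver I) \<and>
    (\<forall>i. sentence (letter I i))"

primrec ptm_val :: "interp \<Rightarrow> ptm \<Rightarrow> nat" where
  "ptm_val I (PVar i) = pvar I i"
| "ptm_val I (PConst i) = pconst I i"
| "ptm_val I (App t s) = op_m I (ptm_val I t) (ptm_val I s)"
| "ptm_val I (Sum t s) = op_a I (ptm_val I t) (ptm_val I s)"
| "ptm_val I (Check t) = op_c I (ptm_val I t)"

primrec star :: "interp \<Rightarrow> lfm \<Rightarrow> fm" where
  "star I (Letter i) = letter I i"
| "star I LBot = Bot"
| "star I (LAnd A B) = And (star I A) (star I B)"
| "star I (LOr A B) = Or (star I A) (star I B)"
| "star I (LImp A B) = Imp (star I A) (star I B)"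
| "star I (Vf A) = ver_app (Ver I) (star I A)"
| "star I (Pf t A) = prf_app (Prf I) (ptm_val I t) (star I A)"

definition CS_interpretation :: "lfm set \<Rightarrow> interp \<Rightarrow> bool" where
  "CS_interpretation CS I \<longleftrightarrow>
    arithmetical_interpretation I \<and> (\<forall>A \<in> CS. arith_true (star I A))"

definition provably_valid :: "lfm set \<Rightarrow> lfm \<Rightarrow> bool" where
  "provably_valid CS F \<longleftrightarrow> (\<forall>I. CS_interpretation CS I \<longrightarrow> PA \<turnstile> star I F)"

end

theory Submission
  imports Defs
begin

text \<open>Everything except the verification axioms rests on the decidability of the proof
  predicate: being provably \<open>\<Delta>\<close>, each instance \<open>Prf(n, F)\<close> is equivalent in PA to a
  \<open>\<Sigma>\<^sub>1\<close> and to a \<open>\<Pi>\<^sub>1\<close> formula, so PA proves it when it is true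
  (\<open>\<Sigma>\<^sub>1\<close>-completeness) and refutes it when it is false. Hence an implication between such
  instances that holds in the standard model is provable, and reflection \<open>t:A \<rightarrow> A\<close> holds since
  a true \<open>Prf(n, F)\<close> yields a proof of \<open>F\<close>.\<close>

section \<open>Substitution\<close>

lemma subst_tm_cong: "(\<And>i. i \<in> fv_tm t \<Longrightarrow> \<sigma> i = \<tau> i) \<Longrightarrow> subst_tm \<sigma> t = subst_tm \<tau> t"
  by (induction t) auto

lemma subst_tm_Var [simp]: "subst_tm Var t = t"
  by (induction t) auto

lemma subst_tm_subst_tm: "subst_tm \<tau> (subst_tm \<sigma> t) = subst_tm (\<lambda>i. subst_tm \<tau> (\<sigma> i)) t"
  by (induction t) auto

lemma fv_subst_tm: "fv_tm (subst_tm \<sigma> t) = (\<Union>i\<in>fv_tm t. fv_tm (\<sigma> i))"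
  by (induction t) auto

lemma eval_subst_tm: "eval_tm e (subst_tm \<sigma> t) = eval_tm (\<lambda>i. eval_tm e (\<sigma> i)) t"
  by (induction t) auto

lemma push_simps [simp]: "push \<sigma> 0 = Var 0" "push \<sigma> (Suc i) = lift_tm (\<sigma> i)"
  by (simp_all add: push_def)

lemma subst_tm_push_lift_tm: "subst_tm (push \<sigma>) (lift_tm t) = lift_tm (subst_tm \<sigma> t)"
  by (simp add: lift_tm_def subst_tm_subst_tm)

lemma subst_tm_case_nat_lift_tm [simp]: "subst_tm (case_nat s \<sigma>) (lift_tm t) = subst_tm \<sigma> t"
  by (simp add: lift_tm_def subst_tm_subst_tm)

text \<open>Passing under a binder respects composition; this carries the quantifier cases of
  \<open>subst_subst\<close>.\<close>

lemma subst_push_push: "(\<lambda>i. subst_tm (push \<tau>) (push \<sigma> i)) = push (\<lambda>i. subst_tm \<tau> (\<sigma> i))"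
proof
  show "subst_tm (push \<tau>) (push \<sigma> i) = push (\<lambda>i. subst_tm \<tau> (\<sigma> i)) i" for i
    by (cases i) (simp_all add: subst_tm_push_lift_tm)
qed

lemma subst_cong: "(\<And>i. i \<in> fv F \<Longrightarrow> \<sigma> i = \<tau> i) \<Longrightarrow> subst \<sigma> F = subst \<tau> F"
proof (induction F arbitrary: \<sigma> \<tau>)
  case (All F)
  have "subst (push \<sigma>) F = subst (push \<tau>) F"
    by (rule All.IH) (use All.prems in \<open>auto simp: push_def split: nat.split\<close>)
  then show ?case by simp
next
  case (Ex F)
  have "subst (push \<sigma>) F = subst (push \<tau>) F"
    by (rule Ex.IH) (use Ex.prems in \<open>auto simp: push_def split: nat.split\<close>)
  then show ?case by simp
next
  case (And F G)
  then show ?case by (metis UnCI fv.simps(4) subst.simps(4))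
next
  case (Or F G)
  then show ?case by (metis UnCI fv.simps(5) subst.simps(5))
next
  case (Imp F G)
  then show ?case by (metis UnCI fv.simps(6) subst.simps(6))
qed (auto intro: subst_tm_cong)

lemma subst_subst: "subst \<tau> (subst \<sigma> F) = subst (\<lambda>i. subst_tm \<tau> (\<sigma> i)) F"
  by (induction F arbitrary: \<sigma> \<tau>) (auto simp: subst_tm_subst_tm subst_push_push)

lemma fv_subst: "fv (subst \<sigma> F) \<subseteq> (\<Union>i\<in>fv F. fv_tm (\<sigma> i))"
proof (induction F arbitrary: \<sigma>)
  case (All F)
  have "i \<in> (\<Union>i\<in>fv (All F). fv_tm (\<sigma> i))" if "Suc i \<in> fv (subst (push \<sigma>) F)" for i
  proof -
    from subsetD[OF All.IH that] obtain j where "j \<in> fv F" "Suc i \<in> fv_tm (push \<sigma> j)" by auto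
    \<comment> \<open>Index 0 is sent to \<open>Var 0\<close>, which yields no index
      \<open>Suc i\<close>; a positive index is sent to a lifted term, whose shift cancels the one
      in \<open>fv (All F)\<close>.\<close>
    then show ?thesis by (cases j) (auto simp: lift_tm_def fv_subst_tm)
  qed
  then show ?case by auto
next
  case (Ex F)
  have "i \<in> (\<Union>i\<in>fv (Ex F). fv_tm (\<sigma> i))" if "Suc i \<in> fv (subst (push \<sigma>) F)" for i
  proof -
    from subsetD[OF Ex.IH that] obtain j where "j \<in> fv F" "Suc i \<in> fv_tm (push \<sigma> j)" by auto
    then show ?thesis by (cases j) (auto simp: lift_tm_def fv_subst_tm)
  qed
  then show ?case by auto
qed (fastforce simp: fv_subst_tm)+

section \<open>Substitution against satisfaction and instantiation\<close>

lemma eval_push: "(\<lambda>i. eval_tm (case_nat n e) (push \<sigma> i)) = case_nat n (\<lambda>i. eval_tm e (\<sigma> i))"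
proof
  show "eval_tm (case_nat n e) (push \<sigma> i) = case_nat n (\<lambda>i. eval_tm e (\<sigma> i)) i" for i
    by (cases i) (simp_all add: lift_tm_def eval_subst_tm)
qed

lemma sat_subst: "sat e (subst \<sigma> F) \<longleftrightarrow> sat (\<lambda>i. eval_tm e (\<sigma> i)) F"
  by (induction F arbitrary: e \<sigma>) (simp_all add: eval_subst_tm eval_push)

lemma sat_inst: "sat e (inst F t) \<longleftrightarrow> sat (case_nat (eval_tm e t) e) F"
proof -
  have "(\<lambda>i. eval_tm e (case_nat t Var i)) = case_nat (eval_tm e t) e"
    by (rule ext) (simp split: nat.split)
  then show ?thesis by (simp add: inst_def sat_subst)
qed

lemma sat_lift: "sat (case_nat n e) (lift F) \<longleftrightarrow> sat e F"
  by (simp add: lift_def sat_subst)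

lemma subst_inst: "subst \<sigma> (inst F t) = inst (subst (push \<sigma>) F) (subst_tm \<sigma> t)"
proof -
  have "(\<lambda>i. subst_tm \<sigma> (case_nat t Var i))
      = (\<lambda>i. subst_tm (case_nat (subst_tm \<sigma> t) Var) (push \<sigma> i))"
    by (rule ext) (simp add: push_def split: nat.split)
  then show ?thesis by (simp add: inst_def subst_subst)
qed

lemma subst_lift: "subst (push \<sigma>) (lift F) = lift (subst \<sigma> F)"
  by (simp add: lift_def subst_subst) (simp add: lift_tm_def)

text \<open>Makes the induction scheme stable under substitution: the successor map touches only the
  bound index, which \<open>push \<sigma>\<close> leaves fixed.\<close>

lemma subst_succ:
  "subst (push \<sigma>) (subst (case_nat (Succ (Var 0)) (\<lambda>i. Var (Suc i))) F)
    = subst (case_nat (Succ (Var 0)) (\<lambda>i. Var (Suc i))) (subst (push \<sigma>) F)"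
proof -
  have "(\<lambda>i. subst_tm (push \<sigma>) (case_nat (Succ (Var 0)) (\<lambda>i. Var (Suc i)) i))
     = (\<lambda>i. subst_tm (case_nat (Succ (Var 0)) (\<lambda>i. Var (Suc i))) (push \<sigma> i))"
    by (rule ext) (simp add: push_def split: nat.split, simp add: lift_tm_def)
  then show ?thesis by (simp add: subst_subst)
qed

text \<open>A valuation can be pulled back along a substitution, so instances of tautologies are
  tautologies.\<close>

lemma prop_eval_subst:
  "prop_eval v (subst \<sigma> F) \<longleftrightarrow> prop_eval (\<lambda>X. prop_eval v (subst \<sigma> X)) F"
  by (induction F) auto

lemma subst_numeral_tm [simp]: "subst_tm \<sigma> (numeral_tm n) = numeral_tm n"
  by (induction n) auto

lemma lift_numeral_tm [simp]: "lift_tm (numeral_tm n) = numeral_tm n"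
  by (simp add: lift_tm_def)

lemma fv_numeral_tm [simp]: "fv_tm (numeral_tm n) = {}"
  by (induction n) auto

lemma eval_numeral_tm [simp]: "eval_tm e (numeral_tm n) = n"
  by (induction n) auto

section \<open>Peano arithmetic\<close>

lemma PA_axioms_sound: "F \<in> PA_axioms \<Longrightarrow> sat e F"
proof (induction rule: PA_axioms.induct)
  case (9 F)
  \<comment> \<open>Evaluating F(x + 1) at n amounts to evaluating F at n + 1, so the scheme reduces
    to ordinary induction.\<close>
  have step: "(\<lambda>i. eval_tm (case_nat n e) (case_nat (Succ (Var 0)) (\<lambda>i. Var (Suc i)) i))
      = case_nat (Suc n) e" for n
    by (rule ext) (simp split: nat.split)
  have "sat (case_nat n e) F"
    if "sat (case_nat 0 e) F" "\<And>n. sat (case_nat n e) F \<Longrightarrow> sat (case_nat (Suc n) e) F" for n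
    using that by (induction n) auto
  then show ?case by (simp add: sat_inst sat_subst step)
qed auto

lemma prop_eval_sat: "prop_eval (sat e) F \<longleftrightarrow> sat e F"
  by (induction F) auto

text \<open>The environment is arbitrary because theorems may have free variables. Soundness later
  carries truth values from the proof predicate to its Sigma1 and Pi1 equivalents.\<close>

lemma PA_sound: "PA \<turnstile> F \<Longrightarrow> sat e F"
proof (induction arbitrary: e rule: PA_proves.induct)
  case (PA_taut F)
  then show ?case using prop_eval_sat by blast
next
  case (PA_all_intro G F)
  then show ?case by (metis sat.simps(6,7) sat_lift)
next
  case (PA_ex_elim F G)
  then show ?case by (metis sat.simps(6,8) sat_lift)
qed (auto simp: PA_axioms_sound sat_inst)

lemma PA_axioms_subst: "F \<in> PA_axioms \<Longrightarrow> subst \<sigma> F \<in> PA_axioms"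
  by (induction rule: PA_axioms.induct)
    (auto simp: subst_inst subst_succ intro: PA_axioms.intros)

text \<open>The quantifier rules use the induction hypothesis at \<open>push \<sigma>\<close>. The
  lemma brings provable equivalences of open formulas down to their closed instances.\<close>

lemma PA_subst: "PA \<turnstile> F \<Longrightarrow> PA \<turnstile> subst \<sigma> F"
proof (induction arbitrary: \<sigma> rule: PA_proves.induct)
  case (PA_taut F)
  show ?case by (rule PA_proves.PA_taut) (subst prop_eval_subst, rule PA_taut)
next
  case (PA_mp F G)
  then show ?case by (metis PA_proves.PA_mp subst.simps(6))
next
  case (PA_all_intro G F)
  then show ?case by (metis PA_proves.PA_all_intro subst.simps(6,7) subst_lift)
next
  case (PA_ex_elim F G)
  then show ?case by (metis PA_proves.PA_ex_elim subst.simps(6,8) subst_lift)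
qed (simp_all add: subst_inst PA_ax PA_axioms_subst PA_eq_refl PA_eq_subst PA_all_elim PA_ex_intro)

section \<open>Propositional reasoning inside PA\<close>

lemma PA_prop1:
  assumes "PA \<turnstile> A" "\<And>v. prop_eval v A \<Longrightarrow> prop_eval v B"
  shows "PA \<turnstile> B"
  using PA_mp[OF PA_taut assms(1), of B] assms(2) by simp

lemma PA_prop2:
  assumes "PA \<turnstile> A" "PA \<turnstile> B" "\<And>v. prop_eval v A \<Longrightarrow> prop_eval v B \<Longrightarrow> prop_eval v C"
  shows "PA \<turnstile> C"
  by (rule PA_mp[OF PA_prop1[OF assms(1)] assms(2)]) (simp add: assms(3))

lemma PA_prop3:
  assumes "PA \<turnstile> A" "PA \<turnstile> B" "PA \<turnstile> C"
    "\<And>v. prop_eval v A \<Longrightarrow> prop_eval v B \<Longrightarrow> prop_eval v C \<Longrightarrow> prop_eval v D"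
  shows "PA \<turnstile> D"
  by (rule PA_mp[OF PA_prop2[OF assms(1,2)] assms(3)]) (simp add: assms(4))

lemma PA_Iff_trans: "PA \<turnstile> Iff A B \<Longrightarrow> PA \<turnstile> Iff B C \<Longrightarrow> PA \<turnstile> Iff A C"
  by (erule (1) PA_prop2) (unfold prop_eval.simps, blast)

text \<open>The conditional says that PA decides the formula in agreement with the metalevel
  statement \<open>p\<close>; this format is used for all decidability results.\<close>

lemma PA_Iff_decided:
  assumes "PA \<turnstile> Iff A B" "PA \<turnstile> (if p then B else Neg B)"
  shows "PA \<turnstile> (if p then A else Neg A)"
  by (rule PA_prop2[OF assms]) (cases p; simp)

lemma PA_gen: "PA \<turnstile> F \<Longrightarrow> PA \<turnstile> All F"
proof -
  assume F: "PA \<turnstile> F"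
  \<comment> \<open>Generalization in the calculus acts on implications only, so a closed tautology
    serves as dummy antecedent.\<close>
  have "PA \<turnstile> Imp (lift (Neg Bot)) F"
    by (rule PA_prop1[OF F]) simp
  from PA_all_intro[OF this] show ?thesis
    by (rule PA_prop1) simp
qed

subsection \<open>Equality\<close>

lemma PA_eq_subst_rule: "PA \<turnstile> Eq s t \<Longrightarrow> PA \<turnstile> inst F s \<Longrightarrow> PA \<turnstile> inst F t"
  by (rule PA_mp[OF PA_mp[OF PA_eq_subst]])

lemma PA_eq_sym:
  assumes "PA \<turnstile> Eq s t"
  shows "PA \<turnstile> Eq t s"
  \<comment> \<open>The template has \<open>Var 0\<close> as the slot for replacement: filling in
    \<open>s\<close> gives \<open>Eq s s\<close>, filling in \<open>t\<close> the goal. Lifting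
    protects the terms that must stay fixed; the next lemmas use the same device.\<close>
  using PA_eq_subst_rule[OF assms, of "Eq (Var 0) (lift_tm s)"] PA_eq_refl
  by (simp add: inst_def)

lemma PA_eq_trans:
  assumes "PA \<turnstile> Eq s t" "PA \<turnstile> Eq t u"
  shows "PA \<turnstile> Eq s u"
  using PA_eq_subst_rule[OF assms(2), of "Eq (lift_tm s) (Var 0)"] assms(1)
  by (simp add: inst_def)

lemma PA_eq_Succ:
  assumes "PA \<turnstile> Eq s t"
  shows "PA \<turnstile> Eq (Succ s) (Succ t)"
  using PA_eq_subst_rule[OF assms, of "Eq (Succ (lift_tm s)) (Succ (Var 0))"] PA_eq_refl
  by (simp add: inst_def)

lemma PA_eq_Add:
  assumes "PA \<turnstile> Eq s s'" "PA \<turnstile> Eq t t'"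
  shows "PA \<turnstile> Eq (Add s t) (Add s' t')"
proof (rule PA_eq_trans)
  show "PA \<turnstile> Eq (Add s t) (Add s' t)"
    using PA_eq_subst_rule[OF assms(1), of "Eq (Add (lift_tm s) (lift_tm t)) (Add (Var 0) (lift_tm t))"]
      PA_eq_refl by (simp add: inst_def)
  show "PA \<turnstile> Eq (Add s' t) (Add s' t')"
    using PA_eq_subst_rule[OF assms(2), of "Eq (Add (lift_tm s') (lift_tm t)) (Add (lift_tm s') (Var 0))"]
      PA_eq_refl by (simp add: inst_def)
qed

lemma PA_eq_Mul:
  assumes "PA \<turnstile> Eq s s'" "PA \<turnstile> Eq t t'"
  shows "PA \<turnstile> Eq (Mul s t) (Mul s' t')"
proof (rule PA_eq_trans)
  show "PA \<turnstile> Eq (Mul s t) (Mul s' t)"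
    using PA_eq_subst_rule[OF assms(1), of "Eq (Mul (lift_tm s) (lift_tm t)) (Mul (Var 0) (lift_tm t))"]
      PA_eq_refl by (simp add: inst_def)
  show "PA \<turnstile> Eq (Mul s' t) (Mul s' t')"
    using PA_eq_subst_rule[OF assms(2), of "Eq (Mul (lift_tm s') (lift_tm t)) (Mul (lift_tm s') (Var 0))"]
      PA_eq_refl by (simp add: inst_def)
qed

lemma PA_Iff_inst:
  assumes "PA \<turnstile> Eq s t"
  shows "PA \<turnstile> Iff (inst F s) (inst F t)"
  by (rule PA_prop2[OF PA_mp[OF PA_eq_subst assms] PA_mp[OF PA_eq_subst PA_eq_sym[OF assms]]]) simp

lemma PA_Iff_Eq:
  assumes "PA \<turnstile> Eq s s'" "PA \<turnstile> Eq t t'"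
  shows "PA \<turnstile> Iff (Eq s t) (Eq s' t')"
proof -
  have "PA \<turnstile> Iff (Eq s t) (Eq s' t)"
    using PA_Iff_inst[OF assms(1), of "Eq (Var 0) (lift_tm t)"] by (simp add: inst_def)
  moreover have "PA \<turnstile> Iff (Eq s' t) (Eq s' t')"
    using PA_Iff_inst[OF assms(2), of "Eq (lift_tm s') (Var 0)"] by (simp add: inst_def)
  ultimately show ?thesis by (rule PA_Iff_trans)
qed

lemma PA_Iff_Less:
  assumes "PA \<turnstile> Eq s s'" "PA \<turnstile> Eq t t'"
  shows "PA \<turnstile> Iff (Less s t) (Less s' t')"
proof -
  have "PA \<turnstile> Iff (Less s t) (Less s' t)"
    using PA_Iff_inst[OF assms(1), of "Less (Var 0) (lift_tm t)"] by (simp add: inst_def)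
  moreover have "PA \<turnstile> Iff (Less s' t) (Less s' t')"
    using PA_Iff_inst[OF assms(2), of "Less (lift_tm s') (Var 0)"] by (simp add: inst_def)
  ultimately show ?thesis by (rule PA_Iff_trans)
qed

subsection \<open>Numerals\<close>

lemma PA_Add_numeral: "PA \<turnstile> Eq (Add (numeral_tm m) (numeral_tm n)) (numeral_tm (m + n))"
proof (induction n)
  case 0
  show ?case by (simp add: PA_ax PA_axioms.intros)
next
  case (Suc n)
  show ?case
    using PA_eq_trans[OF PA_ax[OF PA_axioms.intros(4)] PA_eq_Succ[OF Suc]] by simp
qed

lemma PA_Mul_numeral: "PA \<turnstile> Eq (Mul (numeral_tm m) (numeral_tm n)) (numeral_tm (m * n))"
proof (induction n)
  case 0
  show ?case by (simp add: PA_ax PA_axioms.intros)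
next
  case (Suc n)
  have "PA \<turnstile> Eq (Mul (numeral_tm m) (numeral_tm (Suc n)))
      (Add (numeral_tm (m * n)) (numeral_tm m))"
    using PA_eq_trans[OF PA_ax[OF PA_axioms.intros(6)] PA_eq_Add[OF Suc PA_eq_refl]] by simp
  from PA_eq_trans[OF this PA_Add_numeral] show ?case by (simp add: add.commute)
qed

lemma PA_eval_tm: "PA \<turnstile> Eq (subst_tm (\<lambda>i. numeral_tm (e i)) t) (numeral_tm (eval_tm e t))"
proof (induction t)
  case (Add s t)
  show ?case using PA_eq_trans[OF PA_eq_Add[OF Add] PA_Add_numeral] by simp
next
  case (Mul s t)
  show ?case using PA_eq_trans[OF PA_eq_Mul[OF Mul] PA_Mul_numeral] by simp
qed (auto intro: PA_eq_refl PA_eq_Succ)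

lemma PA_neq_numeral: "m \<noteq> n \<Longrightarrow> PA \<turnstile> Neg (Eq (numeral_tm m) (numeral_tm n))"
proof (induction m arbitrary: n)
  case 0
  then obtain k where n: "n = Suc k" by (cases n) auto
  \<comment> \<open>The axiom denies only that a successor equals zero, so the equation is first
    turned round inside PA.\<close>
  have eq: "PA \<turnstile> Imp (Eq Zero (numeral_tm n)) (Imp (Eq Zero Zero) (Eq (numeral_tm n) Zero))"
    using PA_eq_subst[of Zero "numeral_tm n" "Eq (Var 0) Zero"] by (simp add: inst_def)
  have neq: "PA \<turnstile> Neg (Eq (numeral_tm n) Zero)"
    by (simp add: n PA_ax PA_axioms.intros)
  show ?case
    by (rule PA_prop3[OF eq neq PA_eq_refl[of Zero]]) auto
next
  case (Suc m)
  show ?case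
  proof (cases n)
    case 0
    then show ?thesis by (simp add: PA_ax PA_axioms.intros)
  next
    case (Suc k)
    with Suc.prems have "PA \<turnstile> Neg (Eq (numeral_tm m) (numeral_tm k))"
      by (intro Suc.IH) auto
    then have "PA \<turnstile> Neg (Eq (Succ (numeral_tm m)) (Succ (numeral_tm k)))"
      by (rule PA_prop2[OF _ PA_ax[OF PA_axioms.intros(2)[where s = "numeral_tm m" and t = "numeral_tm k"]]]) simp
    then show ?thesis by (simp add: Suc)
  qed
qed

lemma PA_less_numeral:
  "PA \<turnstile> (if m < n then Less (numeral_tm m) (numeral_tm n) else Neg (Less (numeral_tm m) (numeral_tm n)))"
proof (induction n)
  case 0
  show ?case by (simp add: PA_ax PA_axioms.intros)
next
  case (Suc n)
  have succ: "PA \<turnstile> Iff (Less (numeral_tm m) (numeral_tm (Suc n)))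
      (Or (Less (numeral_tm m) (numeral_tm n)) (Eq (numeral_tm m) (numeral_tm n)))"
    by (simp add: PA_ax PA_axioms.intros)
  have "PA \<turnstile> (if m < Suc n then Or (Less (numeral_tm m) (numeral_tm n)) (Eq (numeral_tm m) (numeral_tm n))
      else Neg (Or (Less (numeral_tm m) (numeral_tm n)) (Eq (numeral_tm m) (numeral_tm n))))"
  proof (cases "m = n")
    case True
    show ?thesis
      by (rule PA_prop1[OF PA_eq_refl[of "numeral_tm m"]]) (simp add: True)
  next
    case False
    show ?thesis
      by (rule PA_prop2[OF Suc PA_neq_numeral[OF False]]) (use False in \<open>cases "m < n"; simp\<close>)
  qed
  with succ show ?case by (rule PA_Iff_decided)
qed

text \<open>Below n + 1, x is either below n or equal to n, and the latter case follows from the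
  instance at n. The second hypothesis forces index 0 to be the only possible free variable of
  \<open>F\<close>.\<close>

lemma PA_bounded_gen:
  assumes "\<And>k. k < n \<Longrightarrow> PA \<turnstile> inst F (numeral_tm k)"
    and "inst F (Var 0) = F"
  shows "PA \<turnstile> Imp (Less (Var 0) (numeral_tm n)) F"
  using assms(1)
proof (induction n)
  case 0
  have "PA \<turnstile> Neg (Less (Var 0) Zero)" by (simp add: PA_ax PA_axioms.intros)
  then show ?case by (rule PA_prop1) simp
next
  case (Suc n)
  have IH: "PA \<turnstile> Imp (Less (Var 0) (numeral_tm n)) F"
    using Suc by simp
  have succ: "PA \<turnstile> Iff (Less (Var 0) (numeral_tm (Suc n)))
      (Or (Less (Var 0) (numeral_tm n)) (Eq (Var 0) (numeral_tm n)))"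
    by (simp add: PA_ax PA_axioms.intros)
  \<comment> \<open>Here the equation is a hypothesis within PA and not a theorem, so symmetry is
    needed as an implication.\<close>
  have sym: "PA \<turnstile> Imp (Eq (Var 0) (numeral_tm n))
      (Imp (Eq (Var 0) (Var 0)) (Eq (numeral_tm n) (Var 0)))"
    using PA_eq_subst[of "Var 0" "numeral_tm n" "Eq (Var 0) (Var 1)"] by (simp add: inst_def)
  have "PA \<turnstile> Imp (Eq (numeral_tm n) (Var 0)) (Imp (inst F (numeral_tm n)) F)"
    using PA_eq_subst[of "numeral_tm n" "Var 0" F] assms(2) by simp
  moreover have "PA \<turnstile> inst F (numeral_tm n)" using Suc.prems by simp
  ultimately have "PA \<turnstile> Imp (Eq (numeral_tm n) (Var 0)) F"
    by (rule PA_prop2) simp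
  then have "PA \<turnstile> Imp (Eq (Var 0) (numeral_tm n)) F"
    by (rule PA_prop3[OF _ sym PA_eq_refl[of "Var 0"]]) simp
  then show ?case by (rule PA_prop3[OF _ IH succ]) (unfold prop_eval.simps, blast)
qed

section \<open>Completeness for true arithmetical sentences of low complexity\<close>

abbreviation close :: "(nat \<Rightarrow> nat) \<Rightarrow> fm \<Rightarrow> fm" where
  "close e \<equiv> subst (\<lambda>i. numeral_tm (e i))"

section \<open>Numeral instances of quantifier bodies and bounded quantification\<close>

lemma push_numeral: "push (\<lambda>i. numeral_tm (e i)) = case_nat (Var 0) (\<lambda>i. numeral_tm (e i))"
  by (rule ext) (simp add: push_def split: nat.split)

lemma inst_close:
  "inst (subst (push (\<lambda>i. numeral_tm (e i))) F) t = subst (case_nat t (\<lambda>i. numeral_tm (e i))) F"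
proof -
  have "(\<lambda>i. subst_tm (case_nat t Var) (push (\<lambda>i. numeral_tm (e i)) i))
      = case_nat t (\<lambda>i. numeral_tm (e i))"
    by (rule ext) (simp add: push_def split: nat.split)
  then show ?thesis by (simp add: inst_def subst_subst)
qed

text \<open>The syntactic counterpart of the quantifier clauses of \<open>sat\<close>: instantiating
  the body at a numeral extends the environment, so inductions over open formulas can
  proceed.\<close>

lemma inst_close_numeral:
  "inst (subst (push (\<lambda>i. numeral_tm (e i))) F) (numeral_tm k) = close (case_nat k e) F"
proof -
  have "case_nat (numeral_tm k) (\<lambda>i. numeral_tm (e i)) = (\<lambda>i. numeral_tm (case_nat k e i))"
    by (rule ext) (simp split: nat.split)
  then show ?thesis by (simp add: inst_close)
qed

lemma inst_close_Var:
  "inst (subst (push (\<lambda>i. numeral_tm (e i))) F) (Var 0) = subst (push (\<lambda>i. numeral_tm (e i))) F"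
  by (simp only: inst_close push_numeral[symmetric])

text \<open>PA evaluates the bound to a numeral, which reduces the claim to
  \<open>PA_bounded_gen\<close>.\<close>

lemma PA_bounded_close:
  assumes "\<And>k. k < eval_tm e t \<Longrightarrow> PA \<turnstile> close (case_nat k e) F"
  shows "PA \<turnstile> Imp (Less (Var 0) (lift_tm (subst_tm (\<lambda>i. numeral_tm (e i)) t)))
    (subst (push (\<lambda>i. numeral_tm (e i))) F)"
proof -
  have bd: "PA \<turnstile> Imp (Less (Var 0) (numeral_tm (eval_tm e t)))
      (subst (push (\<lambda>i. numeral_tm (e i))) F)"
    by (rule PA_bounded_gen) (simp_all add: inst_close_numeral inst_close_Var assms)
  have "PA \<turnstile> Eq (lift_tm (subst_tm (\<lambda>i. numeral_tm (e i)) t)) (numeral_tm (eval_tm e t))"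
    using PA_eval_tm[of e t] by (simp add: lift_tm_def subst_tm_subst_tm)
  from bd PA_Iff_Less[OF PA_eq_refl[of "Var 0"] this] show ?thesis
    by (rule PA_prop2) (unfold prop_eval.simps, blast)
qed

lemma PA_Less_close:
  assumes "k < eval_tm e t"
  shows "PA \<turnstile> Less (numeral_tm k) (subst_tm (\<lambda>i. numeral_tm (e i)) t)"
proof -
  from PA_Iff_decided[OF PA_Iff_Less[OF PA_eq_refl PA_eval_tm] PA_less_numeral]
  have "PA \<turnstile> (if k < eval_tm e t then Less (numeral_tm k) (subst_tm (\<lambda>i. numeral_tm (e i)) t)
      else Neg (Less (numeral_tm k) (subst_tm (\<lambda>i. numeral_tm (e i)) t)))" .
  then show ?thesis unfolding if_P[OF assms] .
qed

text \<open>Atomic formulas are settled by computing with numerals, and a bounded quantifier ranges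
  over finitely many numeral instances.\<close>

lemma Delta0_decided:
  "Delta0 F \<Longrightarrow> PA \<turnstile> (if sat e F then close e F else Neg (close e F))"
proof (induction arbitrary: e rule: Delta0.induct)
  case (1 s t)
  have "PA \<turnstile> (if m = n then Eq (numeral_tm m) (numeral_tm n)
      else Neg (Eq (numeral_tm m) (numeral_tm n)))" for m n
    using PA_eq_refl PA_neq_numeral by simp
  from PA_Iff_decided[OF PA_Iff_Eq[OF PA_eval_tm PA_eval_tm] this] show ?case
    unfolding subst.simps sat.simps .
next
  case (2 s t)
  from PA_Iff_decided[OF PA_Iff_Less[OF PA_eval_tm PA_eval_tm] PA_less_numeral] show ?case
    unfolding subst.simps sat.simps .
next
  case 3
  show ?case by (auto intro: PA_taut)
next
  case (4 F G)
  show ?case by (rule PA_prop2[OF 4(3,4)[of e]]) (cases "sat e F"; cases "sat e G"; simp)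
next
  case (5 F G)
  show ?case by (rule PA_prop2[OF 5(3,4)[of e]]) (cases "sat e F"; cases "sat e G"; simp)
next
  case (6 F G)
  show ?case by (rule PA_prop2[OF 6(3,4)[of e]]) (cases "sat e F"; cases "sat e G"; simp)
next
  case (7 F t)
  let ?A = "All (Imp (Less (Var 0) (lift_tm t)) F)"
  have close: "close e ?A = All (Imp (Less (Var 0) (lift_tm (subst_tm (\<lambda>i. numeral_tm (e i)) t)))
      (subst (push (\<lambda>i. numeral_tm (e i))) F))"
    by (simp add: subst_tm_push_lift_tm)
  have sat: "sat e ?A \<longleftrightarrow> (\<forall>k < eval_tm e t. sat (case_nat k e) F)"
    by (simp add: lift_tm_def eval_subst_tm)
  show ?case
  proof (cases "sat e ?A")
    case True
    then have "PA \<turnstile> close (case_nat k e) F" if "k < eval_tm e t" for k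
      using 7(2)[of "case_nat k e"] that sat by simp
    then have "PA \<turnstile> close e ?A"
      unfolding close by (intro PA_gen PA_bounded_close)
    with True show ?thesis by simp
  next
    case False
    \<comment> \<open>A counterexample below the bound refutes the universal formula through its
      instance at \<open>k\<close>.\<close>
    then obtain k where k: "k < eval_tm e t" "\<not> sat (case_nat k e) F" using sat by auto
    then have neg: "PA \<turnstile> Neg (close (case_nat k e) F)"
      using 7(2)[of "case_nat k e"] by simp
    have "PA \<turnstile> Imp (close e ?A) (inst (Imp (Less (Var 0) (lift_tm (subst_tm (\<lambda>i. numeral_tm (e i)) t)))
      (subst (push (\<lambda>i. numeral_tm (e i))) F)) (numeral_tm k))"
      unfolding close by (rule PA_all_elim)
    then have "PA \<turnstile> Imp (close e ?A)
        (Imp (Less (numeral_tm k) (subst_tm (\<lambda>i. numeral_tm (e i)) t)) (close (case_nat k e) F))"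
      by (simp add: inst_close_numeral[unfolded inst_def] inst_def)
    then have "PA \<turnstile> Neg (close e ?A)"
      by (rule PA_prop3[OF _ PA_Less_close[OF k(1)] neg]) simp
    then show ?thesis unfolding if_not_P[OF False] .
  qed
next
  case (8 F t)
  let ?A = "Ex (And (Less (Var 0) (lift_tm t)) F)"
  let ?F = "subst (push (\<lambda>i. numeral_tm (e i))) F"
  let ?L = "Less (Var 0) (lift_tm (subst_tm (\<lambda>i. numeral_tm (e i)) t))"
  have close: "close e ?A = Ex (And ?L ?F)"
    by (simp add: subst_tm_push_lift_tm)
  have sat: "sat e ?A \<longleftrightarrow> (\<exists>k < eval_tm e t. sat (case_nat k e) F)"
    by (simp add: lift_tm_def eval_subst_tm)
  show ?case
  proof (cases "sat e ?A")
    case True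
    then obtain k where k: "k < eval_tm e t" "sat (case_nat k e) F" using sat by auto
    then have pos: "PA \<turnstile> close (case_nat k e) F"
      using 8(2)[of "case_nat k e"] by simp
    have "PA \<turnstile> Imp (inst (And ?L ?F) (numeral_tm k)) (close e ?A)"
      unfolding close by (rule PA_ex_intro)
    then have "PA \<turnstile> Imp (And (Less (numeral_tm k) (subst_tm (\<lambda>i. numeral_tm (e i)) t))
        (close (case_nat k e) F)) (close e ?A)"
      by (simp add: inst_close_numeral[unfolded inst_def] inst_def)
    then have "PA \<turnstile> close e ?A"
      by (rule PA_prop3[OF _ PA_Less_close[OF k(1)] pos]) simp
    with True show ?thesis by simp
  next
    case False
    then have "PA \<turnstile> close (case_nat k e) (Neg F)" if "k < eval_tm e t" for k
      using 8(2)[of "case_nat k e"] that sat by auto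
    \<comment> \<open>The bounded universal statement for \<open>Neg F\<close> refutes the
      existential one; \<open>Bot\<close> is written as \<open>lift Bot\<close> to fit
      \<open>PA_ex_elim\<close>.\<close>
    from PA_bounded_close[of e t, OF this] have "PA \<turnstile> Imp (And ?L ?F) (lift Bot)"
      by (rule PA_prop1) (auto simp: lift_def)
    from PA_ex_elim[OF this] have "PA \<turnstile> Neg (close e ?A)"
      unfolding close .
    then show ?thesis unfolding if_not_P[OF False] .
  qed
qed

text \<open>An unbounded existential quantifier needs only a numeral witness taken from the standard
  model.\<close>

lemma Sigma1_complete: "Sigma1 F \<Longrightarrow> sat e F \<Longrightarrow> PA \<turnstile> close e F"
proof (induction arbitrary: e rule: Sigma1.induct)
  case (1 F)
  then show ?case using Delta0_decided[of F e] by simp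
next
  case (2 F)
  then obtain k where "sat (case_nat k e) F" by auto
  then have "PA \<turnstile> inst (subst (push (\<lambda>i. numeral_tm (e i))) F) (numeral_tm k)"
    unfolding inst_close_numeral by (rule 2)
  from PA_mp[OF PA_ex_intro this] show ?case by simp
qed

text \<open>Dually, one numeral counterexample refutes a universal quantifier.\<close>

lemma Pi1_refutable: "Pi1 F \<Longrightarrow> \<not> sat e F \<Longrightarrow> PA \<turnstile> Neg (close e F)"
proof (induction arbitrary: e rule: Pi1.induct)
  case (1 F)
  then show ?case using Delta0_decided[of F e] by simp
next
  case (2 F)
  then obtain k where "\<not> sat (case_nat k e) F" by auto
  then have "PA \<turnstile> Neg (inst (subst (push (\<lambda>i. numeral_tm (e i))) F) (numeral_tm k))"
    unfolding inst_close_numeral by (rule 2)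
  then show ?case
    by (rule PA_prop2[OF _ PA_all_elim[of "subst (push (\<lambda>i. numeral_tm (e i))) F" "numeral_tm k"]]) simp
qed

text \<open>The Sigma1 equivalent serves when the instance is true, the Pi1 equivalent when it is
  false.\<close>

lemma provably_Delta_decided:
  assumes "provably_Delta P"
  shows "PA \<turnstile> (if sat e P then close e P else Neg (close e P))"
proof (cases "sat e P")
  case True
  from assms obtain G where G: "Sigma1 G" "PA \<turnstile> Iff P G" by (auto simp: provably_Delta_def)
  have "sat e G" using PA_sound[OF G(2), of e] True by simp
  with G(1) have "PA \<turnstile> close e G" by (rule Sigma1_complete)
  then show ?thesis
    using PA_Iff_decided[OF PA_subst[OF G(2), unfolded subst.simps], of True] True by simp
next
  case False
  from assms obtain H where H: "Pi1 H" "PA \<turnstile> Iff P H" by (auto simp: provably_Delta_def)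
  have "\<not> sat e H" using PA_sound[OF H(2), of e] False by simp
  with H(1) have "PA \<turnstile> Neg (close e H)" by (rule Pi1_refutable)
  then show ?thesis
    using PA_Iff_decided[OF PA_subst[OF H(2), unfolded subst.simps], of False] False by simp
qed

lemma prf_app_decided:
  assumes "provably_Delta P" "fv P \<subseteq> {0, 1}"
  shows "PA \<turnstile> (if arith_true (prf_app P n F) then prf_app P n F else Neg (prf_app P n F))"
proof -
  \<comment> \<open>The value 0 at the other indices is arbitrary, since only 0 and 1 can be free in
    \<open>P\<close>.\<close>
  define e where "e = (\<lambda>i::nat. if i = 0 then n else if i = 1 then gn F else 0)"
  have app: "prf_app P n F = close e P"
    unfolding prf_app_def by (rule subst_cong) (use assms(2) in \<open>auto simp: e_def\<close>)
  have "arith_true (prf_app P n F) \<longleftrightarrow> sat e P"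
    by (simp add: app arith_true_def sat_subst)
  then show ?thesis using provably_Delta_decided[OF assms(1), of e] by (simp only: app)
qed

section \<open>Soundness of the interpretation\<close>

lemma sentence_prf_app: "fv P \<subseteq> {0, 1} \<Longrightarrow> sentence (prf_app P n F)"
  using fv_subst[of "\<lambda>i. if i = 0 then numeral_tm n else if i = 1 then numeral_tm (gn F) else Var i" P]
  by (force simp: sentence_def prf_app_def)

lemma sentence_ver_app: "fv V \<subseteq> {0} \<Longrightarrow> sentence (ver_app V F)"
  using fv_subst[of "\<lambda>i. if i = 0 then numeral_tm (gn F) else Var i" V]
  by (force simp: sentence_def ver_app_def)

text \<open>Needed because normality and the proof operations are constrained only on
  sentences.\<close>

lemma sentence_star:
  assumes "arithmetical_interpretation I"
  shows "sentence (star I A)"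
proof -
  have "fv (Prf I) \<subseteq> {0, 1}" "fv (Ver I) \<subseteq> {0}" "\<And>i. sentence (letter I i)"
    using assms by (simp_all add: arithmetical_interpretation_def normal_proof_predicate_def
        verification_predicate_def)
  then have "sentence (prf_app (Prf I) n F)" "sentence (ver_app (Ver I) F)" for n F
    by (simp_all add: sentence_prf_app sentence_ver_app)
  then show ?thesis
    using \<open>\<And>i. sentence (letter I i)\<close> by (induction A) (simp_all add: sentence_def)
qed

lemma prop_eval_star: "prop_eval v (star I A) \<longleftrightarrow> lprop_eval (\<lambda>X. prop_eval v (star I X)) A"
  by (induction A) auto

text \<open>A refuted antecedent makes the implication vacuous, so \<open>B\<close> has to be proved
  only when the antecedent is true. This turns implications between facts about the standard model
  into theorems of PA.\<close>

lemma PA_imp_decided: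
  assumes "PA \<turnstile> (if p then A else Neg A)" "p \<Longrightarrow> PA \<turnstile> B"
  shows "PA \<turnstile> Imp A B"
proof (cases p)
  case True
  show ?thesis
    by (rule PA_prop1[OF assms(2)[OF True]]) simp
next
  case False
  show ?thesis
    by (rule PA_prop1[OF assms(1)]) (simp add: False)
qed

lemma LPV_axiom_sound:
  assumes I: "arithmetical_interpretation I" and "LPV_axiom A"
  shows "PA \<turnstile> star I A"
proof -
  let ?P = "Prf I"
  have P: "normal_proof_predicate ?P" "proof_operations ?P (op_m I) (op_a I) (op_c I)"
    and V: "verification_predicate ?P (Ver I)"
    using I by (simp_all add: arithmetical_interpretation_def)
  note sent = sentence_star[OF I]
  have dec: "PA \<turnstile> (if arith_true (prf_app ?P n F) then prf_app ?P n F else Neg (prf_app ?P n F))"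
    for n F
    using P(1) by (intro prf_app_decided) (simp_all add: normal_proof_predicate_def)
  have complete: "PA \<turnstile> prf_app ?P n F" if "arith_true (prf_app ?P n F)" for n F
    using dec[of n F] that by simp
  note imp = PA_imp_decided[OF dec]
  let ?holds = "\<lambda>t A. arith_true (prf_app ?P (ptm_val I t) (star I A))"
  have app: "?holds (App t s) B" if "?holds t (LImp A B)" "?holds s A" for t s A B
    using P(2) that sent unfolding proof_operations_def star.simps ptm_val.simps by blast
  have sum: "?holds (Sum t s) A" if "?holds t A \<or> ?holds s A" for t s A
    using P(2) that sent unfolding proof_operations_def ptm_val.simps by blast
  have check: "?holds (Check t) (Pf t A)" if "?holds t A" for t A
    using P(2) that sent unfolding proof_operations_def star.simps ptm_val.simps by blast
  \<comment> \<open>Normality equates provability with the existence of a true instance of the proof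
    predicate, so a true antecedent gives a proof of \<open>star I A\<close> and not merely its
    truth.\<close>
  have reflection: "PA \<turnstile> star I A" if "?holds t A" for t A
    using P(1) that sent unfolding normal_proof_predicate_def by blast
  from assms(2) show ?thesis
  proof cases
    case ax_taut
    show ?thesis by (rule PA_taut) (subst prop_eval_star, rule ax_taut)
  next
    case (ax_app t A B s)
    show ?thesis
      unfolding ax_app star.simps
      \<comment> \<open>Both antecedents are decided and can be stripped in turn; what remains is a
        true instance of the proof predicate.\<close>
      by (rule imp, rule imp, rule complete, rule app[unfolded star.simps])
  next
    case (ax_reflection t A)
    show ?thesis
      unfolding ax_reflection star.simps by (rule imp) (rule reflection)
  next
    case (ax_check t A)
    show ?thesis
      unfolding ax_check star.simps
      by (rule imp, rule complete, rule check[unfolded star.simps])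
  next
    case (ax_sum_right t A s)
    show ?thesis
      unfolding ax_sum_right star.simps by (rule imp, rule complete, rule sum, simp)
  next
    case (ax_sum_left t A s)
    show ?thesis
      unfolding ax_sum_left star.simps by (rule imp, rule complete, rule sum, simp)
  next
    case (ax_ver_K A B)
    then show ?thesis using V by (simp add: verification_predicate_def)
  next
    case (ax_ver_proof t A)
    then show ?thesis using V by (simp add: verification_predicate_def)
  qed
qed

theorem theorem3:
  fixes CS :: "lfm set" and F :: lfm
  assumes "constant_specification CS"
    and "LPV_CS CS F"
  shows "provably_valid CS F"
  unfolding provably_valid_def
proof (intro allI impI)
  fix I
  assume "CS_interpretation CS I"
  then have I: "arithmetical_interpretation I" and CS: "\<And>A. A \<in> CS \<Longrightarrow> arith_true (star I A)"
    by (simp_all add: CS_interpretation_def)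
  from I have P: "provably_Delta (Prf I)" "fv (Prf I) \<subseteq> {0, 1}"
    by (simp_all add: arithmetical_interpretation_def normal_proof_predicate_def)
  from assms(2) show "PA \<turnstile> star I F"
  proof (induction rule: LPV_CS.induct)
    case (LPV_ax A)
    with I show ?case by (rule LPV_axiom_sound)
  next
    case (LPV_cs A)
    with assms(1) obtain i B where "A = Pf (PConst i) B"
      by (auto simp: constant_specification_def)
    \<comment> \<open>A member of \<open>CS\<close> is interpreted as an instance of the proof
      predicate. It is assumed only to be true, and decidability makes it provable.\<close>
    with CS[OF LPV_cs] prf_app_decided[OF P, of "pconst I i" "star I B"] show ?case by simp
  next
    case (LPV_mp A B)
    then show ?case by (auto intro: PA_mp)
  qed
qed

end
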